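(* The sets of non-negative and of sums of squares quaternary quartics invariant under $D_4$ are equal, i.e., $\Sigma_{4,4}^{D_4}=\mathcal{P}_{4,4}^{D_4}$.
   Context: $D_4$ is the group acting on $\mathbb{R}^4$ by coordinate permutations combined with an even number of sign changes. $\mathcal{P}_{4,4}^{D_4}$ is the cone of $D_4$-invariant real forms of degree 4 in four variables that are non-negative on $\mathbb{R}^4$, and $\Sigma_{4,4}^{D_4}$ is the cone of those $D_4$-invariant forms of degree 4 in four variables that are sums of squares of real forms. *)

theory Defs
  imports "HOL-Analysis.Analysis" "HOL-Library.Poly_Mapping"
begin

text \<open>
  Real polynomials in variables indexed by a finite type are finitely supported maps from
  exponent vectors to coefficients; multiplication on \<open>\<Rightarrow>\<^sub>0\<close> is convolution,
  so this is the usual polynomial ring. The exponent of the variable \<open>i\<close> in the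
  monomial \<open>m\<close> is \<open>Poly_Mapping.lookup m i\<close>.
\<close>

type_synonym 'n rpoly = "('n \<Rightarrow>\<^sub>0 nat) \<Rightarrow>\<^sub>0 real"

definition poly_eval :: "'n::finite rpoly \<Rightarrow> real ^ 'n \<Rightarrow> real" where
  "poly_eval p x = (\<Sum>m\<in>Poly_Mapping.keys p. Poly_Mapping.lookup p m * (\<Prod>i\<in>UNIV. (x $ i) ^ Poly_Mapping.lookup m i))"

text \<open>As usual, the zero polynomial counts as a form of every degree.\<close>

definition is_form :: "nat \<Rightarrow> 'n::finite rpoly \<Rightarrow> bool" where
  "is_form d p \<longleftrightarrow> (\<forall>m\<in>Poly_Mapping.keys p. (\<Sum>i\<in>UNIV. Poly_Mapping.lookup m i) = d)"

definition nonneg_poly :: "'n::finite rpoly \<Rightarrow> bool" where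
  "nonneg_poly p \<longleftrightarrow> (\<forall>x. poly_eval p x \<ge> 0)"

definition sum_of_squares_of_forms :: "'n::finite rpoly \<Rightarrow> bool" where
  "sum_of_squares_of_forms p \<longleftrightarrow>
     (\<exists>qs. (\<forall>q\<in>set qs. \<exists>d. is_form d q) \<and> p = (\<Sum>q\<leftarrow>qs. q ^ 2))"

definition signed_perm :: "('n::finite \<Rightarrow> real) \<Rightarrow> ('n \<Rightarrow> 'n) \<Rightarrow> real ^ 'n \<Rightarrow> real ^ 'n" where
  "signed_perm s \<pi> x = (\<chi> i. s i * x $ \<pi> i)"

text \<open>For an index type of size \<open>n\<close> this is the reflection group of type \<open>D\<^sub>n\<close>.\<close>

definition D_group :: "(real ^ 'n::finite \<Rightarrow> real ^ 'n) set" where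
  "D_group = {signed_perm s \<pi> | s \<pi>.
     bij \<pi> \<and> (\<forall>i. s i \<in> {1, -1}) \<and> even (card {i. s i = -1})}"

definition invariant_under :: "(real ^ 'n \<Rightarrow> real ^ 'n) set \<Rightarrow> 'n::finite rpoly \<Rightarrow> bool" where
  "invariant_under G p \<longleftrightarrow> (\<forall>g\<in>G. \<forall>x. poly_eval p (g x) = poly_eval p x)"

definition P44_D4 :: "4 rpoly set" where
  "P44_D4 = {p. is_form 4 p \<and> invariant_under D_group p \<and> nonneg_poly p}"

definition Sigma44_D4 :: "4 rpoly set" where
  "Sigma44_D4 = {p. is_form 4 p \<and> invariant_under D_group p \<and> sum_of_squares_of_forms p}"

end

theory Submission
  imports Defs
begin

text \<open>
  Linear independence of the monomials lets the invariance be read off coefficientwise: a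
  \<open>D\<^sub>4\<close>-invariant quartic is \<open>f = a e\<^sub>4 + b e\<^sub>2 + c x\<^sub>1x\<^sub>2x\<^sub>3x\<^sub>4\<close>, where \<open>e\<^sub>4\<close> is the
  sum of the \<open>x\<^sub>i^4\<close> and \<open>e\<^sub>2\<close> the sum of the \<open>x\<^sub>i^2x\<^sub>j^2\<close> with \<open>i < j\<close>. Evaluating \<open>f\<close> at
  \<open>(1,0,0,0)\<close>, \<open>(1,1,1,1)\<close> and \<open>(1,1,1,-1)\<close> gives \<open>a \<ge> 0\<close> and \<open>4a + 6b \<plusminus> c \<ge> 0\<close>. These three
  inequalities already cut out a simplicial cone, whose extreme rays
  \<open>3e\<^sub>4 - 2e\<^sub>2\<close> and \<open>e\<^sub>2 \<plusminus> 6x\<^sub>1x\<^sub>2x\<^sub>3x\<^sub>4\<close> are the sums of squares of the \<open>x\<^sub>i^2 - x\<^sub>j^2\<close> and of the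
  \<open>x\<^sub>ix\<^sub>j \<plusminus> x\<^sub>kx\<^sub>l\<close>, respectively.
\<close>

section \<open>Monomials as multiplicative characters and their linear independence\<close>

definition monomial_eval :: "('n::finite \<Rightarrow>\<^sub>0 nat) \<Rightarrow> real ^ 'n \<Rightarrow> real" where
  "monomial_eval m x = (\<Prod>i\<in>UNIV. (x $ i) ^ Poly_Mapping.lookup m i)"

lemma monomial_eval_add: "monomial_eval (m + k) x = monomial_eval m x * monomial_eval k x"
  by (simp add: monomial_eval_def lookup_add power_add prod.distrib)

lemma monomial_eval_single: "monomial_eval (Poly_Mapping.single i n) x = (x $ i) ^ n"
proof -
  have "monomial_eval (Poly_Mapping.single i n) x = (\<Prod>j\<in>UNIV. if j = i then (x $ i) ^ n else 1)"
    unfolding monomial_eval_def by (intro prod.cong) (auto simp: lookup_single when_def)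
  then show ?thesis by simp
qed

lemma monomial_eval_mult:
  "monomial_eval m (\<chi> i. x $ i * y $ i) = monomial_eval m x * monomial_eval m y"
  by (simp add: monomial_eval_def power_mult_distrib prod.distrib)

text \<open>At the point with entry 2 in a coordinate where the exponents differ and 1 elsewhere,
  the two values are different powers of 2.\<close>

lemma monomial_eval_separates:
  assumes "m \<noteq> k"
  obtains y where "monomial_eval m y \<noteq> monomial_eval k y"
proof -
  from assms obtain i where i: "Poly_Mapping.lookup m i \<noteq> Poly_Mapping.lookup k i"
    by (meson poly_mapping_eqI)
  have "monomial_eval l (\<chi> j. if j = i then 2 else 1) = 2 ^ Poly_Mapping.lookup l i" for l
  proof -
    have "monomial_eval l (\<chi> j. if j = i then 2 else 1)
        = (\<Prod>j\<in>UNIV. if j = i then 2 ^ Poly_Mapping.lookup l i else 1)"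
      unfolding monomial_eval_def by (intro prod.cong) auto
    then show ?thesis by simp
  qed
  with i have "monomial_eval m (\<chi> j. if j = i then 2 else 1) \<noteq> monomial_eval k (\<chi> j. if j = i then 2 else 1)"
    by simp
  then show thesis by (rule that)
qed

text \<open>Dedekind's argument for the independence of characters.\<close>

lemma monomials_independent:
  assumes "finite A" and "\<And>x. (\<Sum>m\<in>A. c m * monomial_eval m x) = 0" and "m \<in> A"
  shows "c m = 0"
  using assms
proof (induction A arbitrary: c m rule: finite_induct)
  case empty
  then show ?case by simp
next
  case (insert a A)
  have zero: "c k = 0" if "k \<in> A" for k
  proof -
    from that insert.hyps have "k \<noteq> a" by blast
    then obtain y where y: "monomial_eval k y \<noteq> monomial_eval a y"
      by (rule monomial_eval_separates)
    \<comment> \<open>The relation at the coordinatewise product of \<open>x\<close> and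
      \<open>y\<close>, minus \<open>monomial_eval a y\<close> times the relation at
      \<open>x\<close>, loses its \<open>a\<close>-term. The choice of \<open>y\<close> keeps the
      factor multiplying \<open>c k\<close> nonzero.\<close>
    have "(\<Sum>m\<in>A. (c m * (monomial_eval m y - monomial_eval a y)) * monomial_eval m x) = 0" for x
    proof -
      have "(\<Sum>m\<in>A. (c m * (monomial_eval m y - monomial_eval a y)) * monomial_eval m x)
          = (\<Sum>m\<in>insert a A. (c m * (monomial_eval m y - monomial_eval a y)) * monomial_eval m x)"
        using insert.hyps by simp
      also have "\<dots> = (\<Sum>m\<in>insert a A. c m * monomial_eval m (\<chi> i. x $ i * y $ i))
          - monomial_eval a y * (\<Sum>m\<in>insert a A. c m * monomial_eval m x)"
        unfolding sum_distrib_left sum_subtractf[symmetric]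
        by (intro sum.cong) (auto simp: monomial_eval_mult algebra_simps)
      finally show ?thesis using insert.prems(1) by simp
    qed
    from insert.IH[OF this that] y show ?thesis by simp
  qed
  have "c a * monomial_eval a (\<chi> i. 1) = 0"
    using insert.prems(1)[of "\<chi> i. 1"] insert.hyps zero by simp
  then have "c a = 0" by (simp add: monomial_eval_def)
  with zero insert.prems(2) show ?case by blast
qed

section \<open>Evaluation as an injective ring homomorphism\<close>

lemma poly_eval_eq_sum:
  assumes "finite A" and "Poly_Mapping.keys p \<subseteq> A"
  shows "poly_eval p x = (\<Sum>m\<in>A. Poly_Mapping.lookup p m * monomial_eval m x)"
  unfolding poly_eval_def monomial_eval_def[symmetric]
  using assms by (intro sum.mono_neutral_left) (auto simp: in_keys_iff)

lemma poly_eval_zero [simp]: "poly_eval 0 x = 0"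
  by (simp add: poly_eval_def)

lemma poly_eval_single [simp]:
  "poly_eval (Poly_Mapping.single m c) x = c * monomial_eval m x"
  by (subst poly_eval_eq_sum[of "{m}"]) auto

lemma poly_eval_add [simp]: "poly_eval (p + q) x = poly_eval p x + poly_eval q x"
proof -
  let ?A = "Poly_Mapping.keys p \<union> Poly_Mapping.keys q"
  have "poly_eval (p + q) x = (\<Sum>m\<in>?A. Poly_Mapping.lookup (p + q) m * monomial_eval m x)"
    using keys_add[of p q] by (intro poly_eval_eq_sum) auto
  moreover have "poly_eval p x = (\<Sum>m\<in>?A. Poly_Mapping.lookup p m * monomial_eval m x)"
    by (intro poly_eval_eq_sum) auto
  moreover have "poly_eval q x = (\<Sum>m\<in>?A. Poly_Mapping.lookup q m * monomial_eval m x)"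
    by (intro poly_eval_eq_sum) auto
  ultimately show ?thesis by (simp add: lookup_add sum.distrib algebra_simps)
qed

lemma poly_eval_diff [simp]: "poly_eval (p - q) x = poly_eval p x - poly_eval q x"
  using poly_eval_add[of "p - q" q x] by simp

lemma poly_eval_sum: "poly_eval (\<Sum>i\<in>I. f i) x = (\<Sum>i\<in>I. poly_eval (f i) x)"
  by (induction I rule: infinite_finite_induct) auto

lemma poly_eval_sum_list: "poly_eval (sum_list ps) x = (\<Sum>p\<leftarrow>ps. poly_eval p x)"
  by (induction ps) auto

lemma poly_mapping_eq_sum_single:
  "p = (\<Sum>m\<in>Poly_Mapping.keys p. Poly_Mapping.single m (Poly_Mapping.lookup p m))"
  by (rule poly_mapping_eqI) (auto simp: lookup_sum lookup_single when_def in_keys_iff)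

text \<open>By bilinearity it suffices to multiply single terms, where exponents add and
  \<open>monomial_eval_add\<close> applies.\<close>

lemma poly_eval_mult [simp]: "poly_eval (p * q) x = poly_eval p x * poly_eval q x"
proof -
  let ?s = "\<lambda>p m. Poly_Mapping.single m (Poly_Mapping.lookup p m)"
  have "p * q = (\<Sum>m\<in>Poly_Mapping.keys p. \<Sum>k\<in>Poly_Mapping.keys q. ?s p m * ?s q k)"
    using poly_mapping_eq_sum_single[of p] poly_mapping_eq_sum_single[of q]
    by (metis (no_types, lifting) sum_product sum.cong)
  then have "poly_eval (p * q) x
      = (\<Sum>m\<in>Poly_Mapping.keys p. \<Sum>k\<in>Poly_Mapping.keys q. poly_eval (?s p m * ?s q k) x)"
    by (simp only: poly_eval_sum)
  also have "\<dots> = poly_eval p x * poly_eval q x"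
    unfolding poly_eval_eq_sum[OF finite_keys subset_refl] sum_product
    by (intro sum.cong) (auto simp: mult_single monomial_eval_add)
  finally show ?thesis .
qed

lemma poly_eval_square [simp]: "poly_eval (p ^ 2) x = (poly_eval p x) ^ 2"
  by (simp add: power2_eq_square)

text \<open>Independence of the monomials forces every coefficient of \<open>p - q\<close> to
  vanish. This lets the final sum-of-squares identity be checked pointwise.\<close>

lemma poly_eval_inject:
  assumes "\<And>x. poly_eval p x = poly_eval q x"
  shows "p = q"
proof -
  have "(\<Sum>m\<in>Poly_Mapping.keys (p - q). Poly_Mapping.lookup (p - q) m * monomial_eval m x) = 0" for x
    using assms poly_eval_eq_sum[OF finite_keys subset_refl, of "p - q" x] by simp
  from monomials_independent[OF finite_keys this]
  have "Poly_Mapping.keys (p - q) = {}"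
    by (metis equals0I in_keys_iff)
  then show ?thesis by simp
qed

section \<open>Forms, and invariance expressed through coefficients\<close>

lemma is_form_single: "is_form (\<Sum>i\<in>UNIV. Poly_Mapping.lookup m i) (Poly_Mapping.single m c)"
  by (simp add: is_form_def)

lemma is_form_diff: "is_form d p \<Longrightarrow> is_form d q \<Longrightarrow> is_form d (p - q)"
  using keys_diff[of p q] unfolding is_form_def by blast

text \<open>A diagonal substitution multiplies each monomial by its value at \<open>s\<close>.
  Comparing coefficients, every monomial that occurs must have value 1 there.\<close>

lemma lookup_sign_invariant:
  assumes "\<And>x. poly_eval p (\<chi> i. s i * x $ i) = poly_eval p x" and "m \<in> Poly_Mapping.keys p"
  shows "(\<Prod>i\<in>UNIV. s i ^ Poly_Mapping.lookup m i) = 1"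
proof -
  let ?\<chi> = "\<lambda>m. monomial_eval m (\<chi> i. s i)"
  have "(\<Sum>k\<in>Poly_Mapping.keys p. (Poly_Mapping.lookup p k * (?\<chi> k - 1)) * monomial_eval k x) = 0" for x
  proof -
    have "monomial_eval k (\<chi> i. s i * x $ i) = ?\<chi> k * monomial_eval k x" for k
      using monomial_eval_mult[of k "\<chi> i. s i" x] by simp
    with assms(1)[of x] show ?thesis
      unfolding poly_eval_eq_sum[OF finite_keys subset_refl]
      by (simp add: sum_subtractf algebra_simps)
  qed
  from monomials_independent[OF finite_keys this assms(2)] assms(2)
  show ?thesis by (simp add: in_keys_iff monomial_eval_def)
qed

lemma lookup_perm_invariant:
  assumes "bij \<pi>" and inv: "\<And>x. poly_eval p (\<chi> i. x $ \<pi> i) = poly_eval p x"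
  shows "Poly_Mapping.lookup p (Poly_Mapping.map_key \<pi> m) = Poly_Mapping.lookup p m"
proof -
  let ?f = "Poly_Mapping.map_key \<pi>" and ?g = "Poly_Mapping.map_key (inv \<pi>)"
  have inj: "inj \<pi>" "inj (inv \<pi>)"
    using assms(1) by (auto simp: bij_is_inj bij_imp_bij_inv)
  have fg: "?f (?g k) = k" "?g (?f k) = k" for k :: "'a \<Rightarrow>\<^sub>0 nat"
    using assms(1)
    by (auto intro!: poly_mapping_eqI simp: map_key.rep_eq[OF inj(1)] map_key.rep_eq[OF inj(2)]
        bij_is_inj bij_is_surj surj_f_inv_f)
  have eval: "monomial_eval (?f k) (\<chi> i. x $ \<pi> i) = monomial_eval k x" for k x
    unfolding monomial_eval_def
    by (simp add: map_key.rep_eq[OF inj(1)]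
        prod.reindex_bij_betw[OF assms(1), of "\<lambda>i. (x $ i) ^ Poly_Mapping.lookup k i"])
  let ?K = "Poly_Mapping.keys p"
  define A where "A = insert m (?K \<union> ?g ` ?K)"
  have fin: "finite A" by (simp add: A_def)
  have K: "?K \<subseteq> ?f ` A"
  proof
    fix k assume "k \<in> ?K"
    then have "?f (?g k) \<in> ?f ` A" by (auto simp: A_def)
    then show "k \<in> ?f ` A" by (simp only: fg)
  qed
  have "(\<Sum>k\<in>A. (Poly_Mapping.lookup p (?f k) - Poly_Mapping.lookup p k) * monomial_eval k x) = 0" for x
  proof -
    have "poly_eval p x = poly_eval p (\<chi> i. x $ \<pi> i)" by (simp add: inv)
    also have "\<dots> = (\<Sum>k\<in>?f ` A. Poly_Mapping.lookup p k * monomial_eval k (\<chi> i. x $ \<pi> i))"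
      using fin K by (intro poly_eval_eq_sum) auto
    also have "\<dots> = (\<Sum>k\<in>A. Poly_Mapping.lookup p (?f k) * monomial_eval k x)"
      by (subst sum.reindex) (auto simp: eval intro!: inj_on_inverseI[of _ ?g] fg)
    finally have "(\<Sum>k\<in>A. Poly_Mapping.lookup p (?f k) * monomial_eval k x)
        = (\<Sum>k\<in>A. Poly_Mapping.lookup p k * monomial_eval k x)"
      using poly_eval_eq_sum[OF fin, of p x] by (auto simp: A_def)
    then show ?thesis by (simp add: left_diff_distrib sum_subtractf)
  qed
  from monomials_independent[OF fin this, of m] show ?thesis by (simp add: A_def)
qed

lemma D_group_eval_perm:
  assumes "invariant_under D_group p" and "bij \<pi>"
  shows "poly_eval p (\<chi> i. x $ \<pi> i) = poly_eval p x"
proof -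
  have "signed_perm (\<lambda>_. 1) \<pi> \<in> D_group"
    unfolding D_group_def using assms(2) by (intro CollectI exI[of _ "\<lambda>_. 1"] exI[of _ \<pi>]) simp
  with assms(1) have "poly_eval p (signed_perm (\<lambda>_. 1) \<pi> x) = poly_eval p x"
    by (simp add: invariant_under_def)
  then show ?thesis by (simp add: signed_perm_def)
qed

lemma D_group_eval_sign:
  assumes "invariant_under D_group p" and "j \<noteq> k"
  shows "poly_eval p (\<chi> i. (if i \<in> {j, k} then -1 else 1) * x $ i) = poly_eval p x"
proof -
  let ?s = "\<lambda>i. if i \<in> {j, k} then - 1 else 1 :: real"
  have "{i. ?s i = -1} = {j, k}" by auto
  then have "even (card {i. ?s i = -1})" using assms(2) by simp
  then have "signed_perm ?s id \<in> D_group"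
    unfolding D_group_def by (intro CollectI exI[of _ ?s] exI[of _ id]) auto
  with assms(1) have "poly_eval p (signed_perm ?s id x) = poly_eval p x"
    by (simp add: invariant_under_def)
  then show ?thesis by (simp add: signed_perm_def)
qed

text \<open>Flipping the signs of coordinates \<open>j\<close> and \<open>k\<close> is an even sign
  change and scales the monomial by -1 to the sum of the two exponents. Hence all exponents of an
  occurring monomial have the same parity.\<close>

lemma D_group_even_exponents:
  assumes "invariant_under D_group p" and "m \<in> Poly_Mapping.keys p" and "j \<noteq> k"
  shows "even (Poly_Mapping.lookup m j + Poly_Mapping.lookup m k)"
proof -
  let ?s = "\<lambda>i. if i \<in> {j, k} then - 1 else 1 :: real"
  have "(\<Prod>i\<in>UNIV. ?s i ^ Poly_Mapping.lookup m i) = 1"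
    by (rule lookup_sign_invariant[OF D_group_eval_sign[OF assms(1,3)] assms(2)])
  also have "(\<Prod>i\<in>UNIV. ?s i ^ Poly_Mapping.lookup m i) = (\<Prod>i\<in>{j, k}. (-1) ^ Poly_Mapping.lookup m i)"
    by (rule prod.mono_neutral_cong_right) auto
  also have "\<dots> = (-1) ^ (Poly_Mapping.lookup m j + Poly_Mapping.lookup m k)"
    using assms(3) by (simp add: power_add)
  finally show ?thesis by (auto simp: minus_one_power_iff split: if_splits)
qed

section \<open>Invariant quartics in four variables\<close>

text \<open>In the index type \<open>4\<close> the numeral 4 equals 0, so 1, 2, 3, 4 name each index
  exactly once.\<close>

definition exponent4 :: "nat \<Rightarrow> nat \<Rightarrow> nat \<Rightarrow> nat \<Rightarrow> 4 \<Rightarrow>\<^sub>0 nat" where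
  "exponent4 a b c d = Poly_Mapping.single 1 a + Poly_Mapping.single 2 b
     + Poly_Mapping.single 3 c + Poly_Mapping.single 4 d"

lemma lookup_exponent4 [simp]:
  "Poly_Mapping.lookup (exponent4 a b c d) 1 = a"
  "Poly_Mapping.lookup (exponent4 a b c d) 2 = b"
  "Poly_Mapping.lookup (exponent4 a b c d) 3 = c"
  "Poly_Mapping.lookup (exponent4 a b c d) 4 = d"
  by (simp_all add: exponent4_def lookup_add lookup_single)

lemma exponent4_eqI:
  assumes "Poly_Mapping.lookup m 1 = a" "Poly_Mapping.lookup m 2 = b"
    "Poly_Mapping.lookup m 3 = c" "Poly_Mapping.lookup m 4 = d"
  shows "m = exponent4 a b c d"
proof (rule poly_mapping_eqI)
  fix i :: 4
  show "Poly_Mapping.lookup m i = Poly_Mapping.lookup (exponent4 a b c d) i"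
    using exhaust_4[of i] assms by auto
qed

lemma exponent4_inject [simp]:
  "exponent4 a b c d = exponent4 a' b' c' d' \<longleftrightarrow> a = a' \<and> b = b' \<and> c = c' \<and> d = d'"
  by (metis lookup_exponent4)

lemma monomial_eval_exponent4 [simp]:
  "monomial_eval (exponent4 a b c d) x = (x $ 1) ^ a * (x $ 2) ^ b * (x $ 3) ^ c * (x $ 4) ^ d"
  by (simp add: exponent4_def monomial_eval_add monomial_eval_single)

text \<open>Adjacent transpositions generate all permutations, so these three cases suffice to link
  the coefficients within an orbit.\<close>

lemma map_key_transpose_exponent4:
  "Poly_Mapping.map_key (Transposition.transpose 1 2) (exponent4 a b c d) = exponent4 b a c d"
  "Poly_Mapping.map_key (Transposition.transpose 2 3) (exponent4 a b c d) = exponent4 a c b d"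
  "Poly_Mapping.map_key (Transposition.transpose 3 4) (exponent4 a b c d) = exponent4 a b d c"
  by (rule exponent4_eqI; simp add: map_key.rep_eq transpose_def)+

lemma D4_invariant_quartic:
  fixes p :: "4 rpoly"
  assumes "is_form 4 p" and inv: "invariant_under D_group p"
  obtains a b c where "\<And>x. poly_eval p x
    = a * ((x$1)^4 + (x$2)^4 + (x$3)^4 + (x$4)^4)
    + b * ((x$1)^2 * (x$2)^2 + (x$1)^2 * (x$3)^2 + (x$1)^2 * (x$4)^2
         + (x$2)^2 * (x$3)^2 + (x$2)^2 * (x$4)^2 + (x$3)^2 * (x$4)^2)
    + c * (x$1 * x$2 * x$3 * x$4)"
proof -
  let ?l = "\<lambda>a b c d. Poly_Mapping.lookup p (exponent4 a b c d)"
  let ?A = "{exponent4 4 0 0 0, exponent4 0 4 0 0, exponent4 0 0 4 0, exponent4 0 0 0 4,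
    exponent4 2 2 0 0, exponent4 2 0 2 0, exponent4 2 0 0 2,
    exponent4 0 2 2 0, exponent4 0 2 0 2, exponent4 0 0 2 2, exponent4 1 1 1 1}"
  have keys: "Poly_Mapping.keys p \<subseteq> ?A"
  proof
    fix m assume m: "m \<in> Poly_Mapping.keys p"
    define a b c d where "a = Poly_Mapping.lookup m 1" and "b = Poly_Mapping.lookup m 2"
      and "c = Poly_Mapping.lookup m 3" and "d = Poly_Mapping.lookup m 4"
    have deg: "a + b + c + d = 4"
      using assms(1) m by (simp add: is_form_def sum_4 a_def b_def c_def d_def)
    \<comment> \<open>Adjacent pairs already give all four exponents the same parity. In degree 4
      they are then all 1, or even with one 4 or two 2s.\<close>
    have parity: "even (a + b)" "even (b + c)" "even (c + d)"
      unfolding a_def b_def c_def d_def by (rule D_group_even_exponents[OF inv m]; simp)+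
    have "a \<in> {0,1,2,3,4}" "b \<in> {0,1,2,3,4}" "c \<in> {0,1,2,3,4}" "d = 4 - a - b - c"
      using deg by auto
    then have "exponent4 a b c d \<in> ?A"
      using deg parity by (elim insertE emptyE; simp)
    moreover have "m = exponent4 a b c d"
      by (rule exponent4_eqI) (simp_all add: a_def b_def c_def d_def)
    ultimately show "m \<in> ?A" by simp
  qed
  have perm: "Poly_Mapping.lookup p (Poly_Mapping.map_key (Transposition.transpose i j) m)
      = Poly_Mapping.lookup p m" for i j m
    by (rule lookup_perm_invariant[OF _ D_group_eval_perm[OF inv]]) simp_all
  have swap: "?l a b c d = ?l b a c d" "?l a b c d = ?l a c b d" "?l a b c d = ?l a b d c" for a b c d
    using perm[of 1 2 "exponent4 a b c d"] perm[of 2 3 "exponent4 a b c d"]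
      perm[of 3 4 "exponent4 a b c d"] by (simp_all add: map_key_transpose_exponent4)
  \<comment> \<open>Each remaining exponent vector of an orbit is reached by a chain of adjacent
    swaps starting from (4,0,0,0), and below from (2,2,0,0).\<close>
  have fourth: "?l 0 4 0 0 = ?l 4 0 0 0" "?l 0 0 4 0 = ?l 4 0 0 0" "?l 0 0 0 4 = ?l 4 0 0 0"
    using swap(1)[of 4 0 0 0] swap(2)[of 0 4 0 0] swap(3)[of 0 0 4 0] by simp_all
  have square: "?l 2 0 2 0 = ?l 2 2 0 0" "?l 2 0 0 2 = ?l 2 2 0 0" "?l 0 2 2 0 = ?l 2 2 0 0"
    "?l 0 2 0 2 = ?l 2 2 0 0" "?l 0 0 2 2 = ?l 2 2 0 0"
    using swap(2)[of 2 2 0 0] swap(3)[of 2 0 2 0] swap(1)[of 2 0 2 0] swap(1)[of 2 0 0 2]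
      swap(2)[of 0 2 0 2] by simp_all
  show thesis
  proof (rule that[of "?l 4 0 0 0" "?l 2 2 0 0" "?l 1 1 1 1"])
    fix x
    have "poly_eval p x = (\<Sum>m\<in>?A. Poly_Mapping.lookup p m * monomial_eval m x)"
      by (rule poly_eval_eq_sum[OF _ keys]) simp
    also have "\<dots> = ?l 4 0 0 0 * ((x$1)^4 + (x$2)^4 + (x$3)^4 + (x$4)^4)
      + ?l 2 2 0 0 * ((x$1)^2 * (x$2)^2 + (x$1)^2 * (x$3)^2 + (x$1)^2 * (x$4)^2
         + (x$2)^2 * (x$3)^2 + (x$2)^2 * (x$4)^2 + (x$3)^2 * (x$4)^2)
      + ?l 1 1 1 1 * (x$1 * x$2 * x$3 * x$4)"
      by (simp add: fourth square distrib_left)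
    finally show "poly_eval p x = \<dots>" .
  qed
qed

section \<open>Sums of squares and equality of the two cones\<close>

lemma sum_of_squares_imp_nonneg:
  assumes "sum_of_squares_of_forms p"
  shows "nonneg_poly p"
  using assms unfolding sum_of_squares_of_forms_def nonneg_poly_def
  by (auto simp: poly_eval_sum_list intro!: sum_list_nonneg)

text \<open>Two separate coefficients let one shape serve for all the squares needed:
  \<open>i = j\<close> and \<open>k = l\<close> give differences of squares, and a negative
  \<open>s\<close> gives the plus sign.\<close>

definition quadratic_binomial :: "real \<Rightarrow> 4 \<Rightarrow> 4 \<Rightarrow> real \<Rightarrow> 4 \<Rightarrow> 4 \<Rightarrow> 4 rpoly" where
  "quadratic_binomial r i j s k l =
     Poly_Mapping.single (Poly_Mapping.single i 1 + Poly_Mapping.single j 1) r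
     - Poly_Mapping.single (Poly_Mapping.single k 1 + Poly_Mapping.single l 1) s"

lemma is_form_quadratic_binomial: "is_form 2 (quadratic_binomial r i j s k l)"
proof -
  have "(\<Sum>u\<in>UNIV. Poly_Mapping.lookup (Poly_Mapping.single i 1 + Poly_Mapping.single j 1) u) = 2"
    for i j :: 4
    by (simp add: lookup_add lookup_single sum.distrib when_def)
  then show ?thesis
    unfolding quadratic_binomial_def by (metis is_form_diff is_form_single)
qed

lemma poly_eval_quadratic_binomial [simp]:
  "poly_eval (quadratic_binomial r i j s k l) x = r * (x $ i * x $ j) - s * (x $ k * x $ l)"
  by (simp add: quadratic_binomial_def monomial_eval_add monomial_eval_single)

lemma D4_nonneg_imp_sum_of_squares:
  fixes p :: "4 rpoly"
  assumes "is_form 4 p" and "invariant_under D_group p" and nonneg: "nonneg_poly p"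
  shows "sum_of_squares_of_forms p"
proof -
  obtain a b c where p: "\<And>x. poly_eval p x
    = a * ((x$1)^4 + (x$2)^4 + (x$3)^4 + (x$4)^4)
    + b * ((x$1)^2 * (x$2)^2 + (x$1)^2 * (x$3)^2 + (x$1)^2 * (x$4)^2
         + (x$2)^2 * (x$3)^2 + (x$2)^2 * (x$4)^2 + (x$3)^2 * (x$4)^2)
    + c * (x$1 * x$2 * x$3 * x$4)"
    using D4_invariant_quartic[OF assms(1,2)] by metis
  have "a \<ge> 0" "4 * a + 6 * b + c \<ge> 0" "4 * a + 6 * b - c \<ge> 0"
    using nonneg[unfolded nonneg_poly_def, rule_format, of "\<chi> i. if i = 1 then 1 else 0"]
      nonneg[unfolded nonneg_poly_def, rule_format, of "\<chi> i. 1"]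
      nonneg[unfolded nonneg_poly_def, rule_format, of "\<chi> i. if i = 4 then -1 else 1"]
    by (simp_all add: p)
  \<comment> \<open>The squares of \<open>u\<close>, \<open>v\<close>, \<open>w\<close> are the
    coordinates of \<open>p\<close> on the three extreme rays. Each test point annihilates two ray
    generators, and the third takes the value 3 or 12 there, which explains the
    denominators.\<close>
  moreover define u v w where "u = sqrt (a / 3)" and "v = sqrt ((4 * a + 6 * b - c) / 12)"
    and "w = sqrt ((4 * a + 6 * b + c) / 12)"
  ultimately have sq: "u\<^sup>2 = a / 3" "v\<^sup>2 = (4 * a + 6 * b - c) / 12" "w\<^sup>2 = (4 * a + 6 * b + c) / 12"
    by simp_all
  have a: "a = 3 * u\<^sup>2" and b: "b = v\<^sup>2 + w\<^sup>2 - 2 * u\<^sup>2" and c: "c = 6 * w\<^sup>2 - 6 * v\<^sup>2"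
    unfolding sq by (simp_all add: field_simps)
  \<comment> \<open>The six \<open>u\<close>-terms run over all pairs of variables; the
    \<open>v\<close>- and \<open>w\<close>-terms run over the three splittings of the four indices
    into two pairs.\<close>
  define qs where "qs =
    [quadratic_binomial u 1 1 u 2 2, quadratic_binomial u 1 1 u 3 3, quadratic_binomial u 1 1 u 4 4,
     quadratic_binomial u 2 2 u 3 3, quadratic_binomial u 2 2 u 4 4, quadratic_binomial u 3 3 u 4 4,
     quadratic_binomial v 1 2 v 3 4, quadratic_binomial v 1 3 v 2 4, quadratic_binomial v 1 4 v 2 3,
     quadratic_binomial w 1 2 (-w) 3 4, quadratic_binomial w 1 3 (-w) 2 4, quadratic_binomial w 1 4 (-w) 2 3]"
  have "p = (\<Sum>q\<leftarrow>qs. q ^ 2)"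
  proof (rule poly_eval_inject)
    fix x
    show "poly_eval p x = poly_eval (\<Sum>q\<leftarrow>qs. q ^ 2) x"
      unfolding p qs_def a b c
      by (simp add: algebra_simps power2_eq_square power4_eq_xxxx)
  qed
  moreover have "\<forall>q\<in>set qs. \<exists>d. is_form d q"
    by (auto simp: qs_def intro: is_form_quadratic_binomial)
  ultimately show ?thesis unfolding sum_of_squares_of_forms_def by blast
qed

theorem corollary4p24: "Sigma44_D4 = P44_D4"
  unfolding Sigma44_D4_def P44_D4_def
  using sum_of_squares_imp_nonneg D4_nonneg_imp_sum_of_squares by blast

end
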